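(* Let $\Omega$ be a continuous signature and let $\mathbf{A}=(A,E)$ be a topological algebra of type $\Omega$. Then the following are equivalent: (1) $\mathbf{A}$ is profinite; (2) $A$ is a Stone space and the translation monoid $M(\mathbf{A})$ is equicontinuous (with respect to the unique uniformity on $A$ inducing its topology).
   Context: A continuous signature is a sequence $\Omega=(\Omega_n)_{n\in\mathbb{N}}$ of pairwise disjoint topological spaces. A topological $\Omega$-algebra is $\mathbf{A}=(A,E)$ with $A$ a topological space and continuous maps $E_n\colon\Omega_n\times A^n\to A$. $\mathbf{A}$ is profinite if $A$ is compact and for any distinct $x,y\in A$ there are a finite discrete topological $\Omega$-algebra $\mathbf{B}$ and a continuous homomorphism $\phi\colon\mathbf{A}\to\mathbf{B}$ with $\phi(x)\ne\phi(y)$. A Stone space is a totally disconnected compact Hausdorff space. A translation of $\mathbf{A}$ is a map $z\mapsto E_n(\omega,a_1,\dots,a_{i-1},z,a_{i+1},\dots,a_n)$ ($n\ge1$, $\omega\in\Omega_n$, $1\le i\le n$, fixed $a_j\in A$); $M(\mathbf{A})$ is the submonoid of $(A^A,\circ)$ generated by all translations. For a compact Hausdorff space $A$, the entourages of its unique compatible uniformity are the subsets of $A\times A$ containing an open set that contains the diagonal; a set $F$ of maps $A\to A$ is equicontinuous if for every $z\in A$ and every entourage $\alpha$ there is a neighbourhood $U$ of $z$ with $f(U)\times f(U)\subseteq\alpha$ for all $f\in F$. *)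

theory Defs
  imports "HOL-Analysis.Analysis"
begin

text \<open>
  The power \<open>A\<^sup>n\<close> is the library product of \<open>n\<close> copies of \<open>A\<close> over the index set \<open>{..<n}\<close>;
  coordinates are numbered from \<open>0\<close>, and \<open>A\<^sup>0\<close> has exactly one point.
\<close>

definition continuous_signature :: "(nat \<Rightarrow> 'o topology) \<Rightarrow> bool" where
  "continuous_signature \<Omega> \<longleftrightarrow>
     (\<forall>m n. m \<noteq> n \<longrightarrow> disjnt (topspace (\<Omega> m)) (topspace (\<Omega> n)))"

definition topological_algebra ::
  "(nat \<Rightarrow> 'o topology) \<Rightarrow> 'a topology \<Rightarrow> (nat \<Rightarrow> 'o \<times> (nat \<Rightarrow> 'a) \<Rightarrow> 'a) \<Rightarrow> bool" where
  "topological_algebra \<Omega> A E \<longleftrightarrow>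
     (\<forall>n. continuous_map (prod_topology (\<Omega> n) (product_topology (\<lambda>i. A) {..<n})) A (E n))"

definition continuous_hom ::
  "(nat \<Rightarrow> 'o topology) \<Rightarrow> 'a topology \<Rightarrow> (nat \<Rightarrow> 'o \<times> (nat \<Rightarrow> 'a) \<Rightarrow> 'a) \<Rightarrow>
   'b topology \<Rightarrow> (nat \<Rightarrow> 'o \<times> (nat \<Rightarrow> 'b) \<Rightarrow> 'b) \<Rightarrow> ('a \<Rightarrow> 'b) \<Rightarrow> bool" where
  "continuous_hom \<Omega> A E B F \<phi> \<longleftrightarrow>
     continuous_map A B \<phi> \<and>
     (\<forall>n. \<forall>\<omega> \<in> topspace (\<Omega> n). \<forall>a \<in> {..<n} \<rightarrow>\<^sub>E topspace A.
        \<phi> (E n (\<omega>, a)) = F n (\<omega>, \<lambda>i\<in>{..<n}. \<phi> (a i)))"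

definition finite_discrete_algebra ::
  "(nat \<Rightarrow> 'o topology) \<Rightarrow> 'b topology \<Rightarrow> (nat \<Rightarrow> 'o \<times> (nat \<Rightarrow> 'b) \<Rightarrow> 'b) \<Rightarrow> bool" where
  "finite_discrete_algebra \<Omega> B F \<longleftrightarrow>
     topological_algebra \<Omega> B F \<and> finite (topspace B) \<and> B = discrete_topology (topspace B)"

text \<open>
  HOL cannot quantify over the type carrying the finite algebra, so its carrier is taken to be a
  finite set of natural numbers. Every finite discrete algebra is isomorphic to one of this form;
  lemma \<open>profinite_algebraI\<close> below shows that admitting carriers in another type would give
  the same notion.
\<close>

definition profinite_algebra ::
  "(nat \<Rightarrow> 'o topology) \<Rightarrow> 'a topology \<Rightarrow> (nat \<Rightarrow> 'o \<times> (nat \<Rightarrow> 'a) \<Rightarrow> 'a) \<Rightarrow> bool" where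
  "profinite_algebra \<Omega> A E \<longleftrightarrow>
     compact_space A \<and>
     (\<forall>x \<in> topspace A. \<forall>y \<in> topspace A. x \<noteq> y \<longrightarrow>
        (\<exists>(B :: nat topology) F \<phi>.
           finite_discrete_algebra \<Omega> B F \<and> continuous_hom \<Omega> A E B F \<phi> \<and> \<phi> x \<noteq> \<phi> y))"

definition totally_disconnected_space :: "'a topology \<Rightarrow> bool" where
  "totally_disconnected_space A \<longleftrightarrow> (\<forall>C. connectedin A C \<longrightarrow> (\<forall>x\<in>C. \<forall>y\<in>C. x = y))"

definition Stone_space :: "'a topology \<Rightarrow> bool" where
  "Stone_space A \<longleftrightarrow> totally_disconnected_space A \<and> compact_space A \<and> Hausdorff_space A"

text \<open>
  Self-maps of the space \<open>A\<close> are represented by the extensional functions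
  \<open>topspace A \<rightarrow>\<^sub>E topspace A\<close>. In a translation, the parameter tuple \<open>a\<close> has no entry at the
  variable position \<open>i\<close>.
\<close>

definition algebra_translations ::
  "(nat \<Rightarrow> 'o topology) \<Rightarrow> 'a topology \<Rightarrow> (nat \<Rightarrow> 'o \<times> (nat \<Rightarrow> 'a) \<Rightarrow> 'a) \<Rightarrow> ('a \<Rightarrow> 'a) set" where
  "algebra_translations \<Omega> A E =
     {(\<lambda>z\<in>topspace A. E n (\<omega>, a(i := z))) | n \<omega> i a.
        n \<ge> 1 \<and> \<omega> \<in> topspace (\<Omega> n) \<and> i < n \<and> a \<in> ({..<n} - {i}) \<rightarrow>\<^sub>E topspace A}"

inductive_set translation_monoid ::
  "(nat \<Rightarrow> 'o topology) \<Rightarrow> 'a topology \<Rightarrow> (nat \<Rightarrow> 'o \<times> (nat \<Rightarrow> 'a) \<Rightarrow> 'a) \<Rightarrow> ('a \<Rightarrow> 'a) set"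
  for \<Omega> A E where
  one: "(\<lambda>z\<in>topspace A. z) \<in> translation_monoid \<Omega> A E"
| gen: "f \<in> algebra_translations \<Omega> A E \<Longrightarrow> f \<in> translation_monoid \<Omega> A E"
| mult: "f \<in> translation_monoid \<Omega> A E \<Longrightarrow> g \<in> translation_monoid \<Omega> A E \<Longrightarrow>
         compose (topspace A) f g \<in> translation_monoid \<Omega> A E"

text \<open>
  The next two notions are meant for compact Hausdorff \<open>A\<close>, where \<open>entourages A\<close> is the unique
  uniformity inducing the topology.
\<close>

definition entourages :: "'a topology \<Rightarrow> ('a \<times> 'a) set set" where
  "entourages A =
     {\<alpha>. \<alpha> \<subseteq> topspace A \<times> topspace A \<and>
         (\<exists>W. openin (prod_topology A A) W \<and> Id_on (topspace A) \<subseteq> W \<and> W \<subseteq> \<alpha>)}"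

definition equicontinuous :: "'a topology \<Rightarrow> ('a \<Rightarrow> 'a) set \<Rightarrow> bool" where
  "equicontinuous A \<F> \<longleftrightarrow>
     (\<forall>z \<in> topspace A. \<forall>\<alpha> \<in> entourages A.
        \<exists>U. openin A U \<and> z \<in> U \<and> (\<forall>f \<in> \<F>. (f ` U) \<times> (f ` U) \<subseteq> \<alpha>))"

lemma profinite_algebraI:
  fixes \<Omega> :: "nat \<Rightarrow> 'o topology"
    and A :: "'a topology" and E :: "nat \<Rightarrow> 'o \<times> (nat \<Rightarrow> 'a) \<Rightarrow> 'a"
  assumes "compact_space A"
    and sep: "\<And>x y. x \<in> topspace A \<Longrightarrow> y \<in> topspace A \<Longrightarrow> x \<noteq> y \<Longrightarrow>
        \<exists>(B :: 'b topology) F \<phi>.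
          finite_discrete_algebra \<Omega> B F \<and> continuous_hom \<Omega> A E B F \<phi> \<and> \<phi> x \<noteq> \<phi> y"
  shows "profinite_algebra \<Omega> A E"
  unfolding profinite_algebra_def
proof (intro conjI ballI impI)
  show "compact_space A" by fact
  fix x y assume xy: "x \<in> topspace A" "y \<in> topspace A" "x \<noteq> y"
  obtain B :: "'b topology" and F \<phi> where B: "finite_discrete_algebra \<Omega> B F"
    and hom: "continuous_hom \<Omega> A E B F \<phi>" and ne: "\<phi> x \<noteq> \<phi> y"
    using sep[OF xy] by blast
  define S where "S = topspace B"
  have fin: "finite S" and Bd: "B = discrete_topology S"
    using B by (auto simp: finite_discrete_algebra_def S_def)
  obtain f :: "'b \<Rightarrow> nat" where f: "inj_on f S"
    using finite_imp_inj_to_nat_seg[OF fin] by blast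
  define g where "g = inv_into S f"
  define C where "C = discrete_topology (f ` S)"
  define G where "G = (\<lambda>n (p :: 'o \<times> (nat \<Rightarrow> nat)). f (F n (fst p, \<lambda>i\<in>{..<n}. g (snd p i))))"
  have gf: "g (f s) = s" if "s \<in> S" for s
    using that f by (simp add: g_def)
  have cf: "continuous_map B C f"
    by (auto simp: Bd C_def)
  have cg: "continuous_map C B g"
    by (auto simp: Bd C_def gf)
  have cF: "continuous_map (prod_topology (\<Omega> n) (product_topology (\<lambda>i. B) {..<n})) B (F n)" for n
    using B by (auto simp: finite_discrete_algebra_def topological_algebra_def)
  have cG: "continuous_map (prod_topology (\<Omega> n) (product_topology (\<lambda>i. C) {..<n})) C (G n)" for n
  proof -
    have "continuous_map (prod_topology (\<Omega> n) (product_topology (\<lambda>i. C) {..<n})) B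
            (\<lambda>p. g (snd p i))" if "i < n" for i
      using continuous_map_compose[OF continuous_map_compose[OF continuous_map_snd
          continuous_map_product_projection[of i "{..<n}" "\<lambda>i. C"]] cg] that
      by (simp add: o_def)
    then have "continuous_map (prod_topology (\<Omega> n) (product_topology (\<lambda>i. C) {..<n}))
        (product_topology (\<lambda>i. B) {..<n}) (\<lambda>p. \<lambda>i\<in>{..<n}. g (snd p i))"
      by (subst continuous_map_componentwise) auto
    then have "continuous_map (prod_topology (\<Omega> n) (product_topology (\<lambda>i. C) {..<n}))
        (prod_topology (\<Omega> n) (product_topology (\<lambda>i. B) {..<n}))
        (\<lambda>p. (fst p, \<lambda>i\<in>{..<n}. g (snd p i)))"
      by (intro continuous_map_pairedI continuous_map_fst)
    from continuous_map_compose[OF continuous_map_compose[OF this cF] cf]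
    show ?thesis by (simp add: o_def G_def)
  qed
  have \<phi>S: "\<phi> a \<in> S" if "a \<in> topspace A" for a
    using hom that unfolding S_def continuous_hom_def continuous_map_def by auto
  have "finite_discrete_algebra \<Omega> C G"
    using cG fin by (simp add: finite_discrete_algebra_def topological_algebra_def C_def)
  moreover have "continuous_hom \<Omega> A E C G (f \<circ> \<phi>)"
    unfolding continuous_hom_def
  proof (intro conjI allI ballI)
    show "continuous_map A C (f \<circ> \<phi>)"
      using hom cf by (auto simp: continuous_hom_def intro: continuous_map_compose)
    fix n \<omega> a assume \<omega>: "\<omega> \<in> topspace (\<Omega> n)" and a: "a \<in> {..<n} \<rightarrow>\<^sub>E topspace A"
    have "(\<lambda>i\<in>{..<n}. g ((\<lambda>i\<in>{..<n}. (f \<circ> \<phi>) (a i)) i)) = (\<lambda>i\<in>{..<n}. \<phi> (a i))"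
      by (rule restrict_ext) (simp add: gf \<phi>S PiE_mem[OF a])
    moreover have "\<phi> (E n (\<omega>, a)) = F n (\<omega>, \<lambda>i\<in>{..<n}. \<phi> (a i))"
      using hom \<omega> a unfolding continuous_hom_def by blast
    ultimately show "(f \<circ> \<phi>) (E n (\<omega>, a)) = G n (\<omega>, \<lambda>i\<in>{..<n}. (f \<circ> \<phi>) (a i))"
      unfolding G_def fst_conv snd_conv by (simp only: o_apply)
  qed
  moreover have "(f \<circ> \<phi>) x \<noteq> (f \<circ> \<phi>) y"
    using ne inj_onD[OF f _ \<phi>S[OF xy(1)] \<phi>S[OF xy(2)]] by auto
  ultimately show "\<exists>(B :: nat topology) F \<phi>.
      finite_discrete_algebra \<Omega> B F \<and> continuous_hom \<Omega> A E B F \<phi> \<and> \<phi> x \<noteq> \<phi> y"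
    by blast
qed

end

theory Submission
  imports Defs
begin

text \<open>
  Kernels of homomorphisms into finite discrete algebras are clopen and invariant under
  \<open>M(A)\<close>. If the algebra is profinite, compactness of \<open>A \<times> A\<close> puts a finite intersection of such
  kernels inside any given entourage, and the classes of that intersection witness equicontinuity.

  Conversely, let \<open>K\<close> be a clopen set separating two points, and relate \<open>u\<close> and \<open>v\<close> when
  \<open>f u \<in> K \<longleftrightarrow> f v \<in> K\<close> for every \<open>f \<in> M(A)\<close>. Equicontinuity makes the classes of this
  equivalence open, hence finite in number by compactness. It is compatible with translations,
  and therefore, by changing one argument at a time, with all operations; the quotient is
  the required finite algebra.
\<close>

section \<open>Translations, homomorphism kernels and congruences\<close>

lemma topological_algebra_in_topspace:
  assumes "topological_algebra \<Omega> A E" "\<omega> \<in> topspace (\<Omega> n)" "a \<in> {..<n} \<rightarrow>\<^sub>E topspace A"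
  shows "E n (\<omega>, a) \<in> topspace A"
proof -
  have "continuous_map (prod_topology (\<Omega> n) (product_topology (\<lambda>i. A) {..<n})) A (E n)"
    using assms(1) by (simp add: topological_algebra_def)
  from continuous_map_funspace[OF this] show ?thesis
    using assms(2,3) by (auto simp: Pi_iff)
qed

lemma fun_upd_in_PiE:
  assumes "a \<in> (I - {i}) \<rightarrow>\<^sub>E S" "i \<in> I" "z \<in> S"
  shows "a(i := z) \<in> I \<rightarrow>\<^sub>E S"
  using assms by (auto simp: PiE_iff extensional_def)

lemma translation_monoid_in_topspace:
  assumes "topological_algebra \<Omega> A E" "f \<in> translation_monoid \<Omega> A E" "z \<in> topspace A"
  shows "f z \<in> topspace A"
  using assms(2,3)
proof (induction arbitrary: z)
  case (gen f)
  then obtain n \<omega> i a where f: "f = (\<lambda>z\<in>topspace A. E n (\<omega>, a(i := z)))"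
    and "\<omega> \<in> topspace (\<Omega> n)" "i < n" "a \<in> ({..<n} - {i}) \<rightarrow>\<^sub>E topspace A"
    by (auto simp: algebra_translations_def)
  then show ?case
    using gen.prems topological_algebra_in_topspace[OF assms(1)]
    by (simp add: fun_upd_in_PiE)
qed (auto simp: compose_def)

text \<open>A translation varies a single argument, so if \<open>\<phi>\<close> identifies
  \<open>u\<close> and \<open>v\<close>, it sends the two argument tuples to the same tuple in
  \<open>B\<close>. Induction extends this to composites.\<close>

lemma translation_monoid_respects_kernel:
  assumes A: "topological_algebra \<Omega> A E" and hom: "continuous_hom \<Omega> A E B F \<phi>"
    and "f \<in> translation_monoid \<Omega> A E"
    and "u \<in> topspace A" "v \<in> topspace A" "\<phi> u = \<phi> v"
  shows "\<phi> (f u) = \<phi> (f v)"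
  using assms(3-)
proof (induction arbitrary: u v)
  case (gen f)
  then obtain n \<omega> i a where f: "f = (\<lambda>z\<in>topspace A. E n (\<omega>, a(i := z)))"
    and *: "\<omega> \<in> topspace (\<Omega> n)" "i < n" "a \<in> ({..<n} - {i}) \<rightarrow>\<^sub>E topspace A"
    by (auto simp: algebra_translations_def)
  have "\<phi> (E n (\<omega>, a(i := z))) = F n (\<omega>, \<lambda>j\<in>{..<n}. \<phi> ((a(i := z)) j))"
    if "z \<in> topspace A" for z
    using hom * fun_upd_in_PiE[OF *(3) _ that] by (simp add: continuous_hom_def)
  moreover have "(\<lambda>j\<in>{..<n}. \<phi> ((a(i := u)) j)) = (\<lambda>j\<in>{..<n}. \<phi> ((a(i := v)) j))"
    using gen.prems by (intro restrict_ext) auto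
  ultimately show ?case
    using gen.prems f by (simp del: fun_upd_apply)
next
  case (mult f g)
  have "\<phi> (f (g u)) = \<phi> (f (g v))"
    using mult.prems translation_monoid_in_topspace[OF A mult.hyps(2)] by (intro mult.IH)
  then show ?case
    using mult.prems by (simp add: compose_def)
qed auto

text \<open>The tuples \<open>a\<close> and \<open>b\<close> are joined by a chain in which
  neighbours differ in one coordinate. Each link is a translation applied to a related pair, and
  transitivity composes the links.\<close>

lemma operation_compatible_if_translation_compatible:
  assumes A: "topological_algebra \<Omega> A E"
    and refl: "\<And>u. u \<in> topspace A \<Longrightarrow> R u u"
    and trans: "\<And>u v w. R u v \<Longrightarrow> R v w \<Longrightarrow> R u w"
    and transl: "\<And>t u v. t \<in> algebra_translations \<Omega> A E \<Longrightarrow> u \<in> topspace A \<Longrightarrow>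
                   v \<in> topspace A \<Longrightarrow> R u v \<Longrightarrow> R (t u) (t v)"
    and \<omega>: "\<omega> \<in> topspace (\<Omega> n)"
    and a: "a \<in> {..<n} \<rightarrow>\<^sub>E topspace A" and b: "b \<in> {..<n} \<rightarrow>\<^sub>E topspace A"
    and ab: "\<And>i. i < n \<Longrightarrow> R (a i) (b i)"
  shows "R (E n (\<omega>, a)) (E n (\<omega>, b))"
proof -
  \<comment> \<open>The chain: entries before position \<open>k\<close> are already replaced, so it
    runs from \<open>c 0 = a\<close> to \<open>c n = b\<close>.\<close>
  define c where "c k = (\<lambda>i. if i < k then b i else a i)" for k :: nat
  have c: "c k \<in> {..<n} \<rightarrow>\<^sub>E topspace A" if "k \<le> n" for k
    using a b that by (auto simp: c_def PiE_iff extensional_def)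
  have "R (E n (\<omega>, a)) (E n (\<omega>, c k))" if "k \<le> n" for k
    using that
  proof (induction k)
    case 0
    have "c 0 = a" by (simp add: c_def)
    then show ?case
      by (simp add: refl topological_algebra_in_topspace[OF A \<omega> a])
  next
    case (Suc k)
    \<comment> \<open>Deleting entry \<open>k\<close> gives the parameter tuple of a translation
      that takes \<open>a k\<close> to the value at \<open>c k\<close> and \<open>b k\<close> to the
      value at \<open>c (Suc k)\<close>.\<close>
    define d where "d = restrict (c k) ({..<n} - {k})"
    have d: "d \<in> ({..<n} - {k}) \<rightarrow>\<^sub>E topspace A"
      using c[of k] Suc.prems by (auto simp: d_def PiE_iff)
    have "d(k := a k) = c k" "d(k := b k) = c (Suc k)"
      using a b Suc.prems by (auto simp: d_def c_def fun_eq_iff less_Suc_eq PiE_iff extensional_def)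
    moreover have "(\<lambda>z\<in>topspace A. E n (\<omega>, d(k := z))) \<in> algebra_translations \<Omega> A E"
    proof -
      have "n \<ge> 1" "k < n" using Suc.prems by auto
      then show ?thesis unfolding algebra_translations_def using \<omega> d by blast
    qed
    moreover have "a k \<in> topspace A" "b k \<in> topspace A" "R (a k) (b k)"
      using a b ab Suc.prems by auto
    ultimately have "R (E n (\<omega>, c k)) (E n (\<omega>, c (Suc k)))"
      using transl[of "\<lambda>z\<in>topspace A. E n (\<omega>, d(k := z))" "a k" "b k"]
      by (simp del: fun_upd_apply)
    then show ?case
      using Suc.IH Suc.prems trans by (meson Suc_leD)
  qed
  moreover have "c n = b"
    using a b by (auto simp: c_def fun_eq_iff PiE_iff extensional_def)
  ultimately show ?thesis
    by (metis order_refl)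
qed

text \<open>In a compact Hausdorff space quasi-components are connected components, and total
  disconnectedness makes these singletons.\<close>

lemma Stone_space_clopen_separation:
  assumes "Stone_space A" "x \<in> topspace A" "y \<in> topspace A" "x \<noteq> y"
  obtains K where "openin A K" "closedin A K" "x \<in> K" "y \<notin> K"
proof -
  have "compact_space A" "Hausdorff_space A" and td: "totally_disconnected_space A"
    using assms(1) by (auto simp: Stone_space_def)
  then have "quasi_component_of A x = connected_component_of A x"
    by (simp add: quasi_eq_connected_component_of)
  moreover have "\<not> connected_component_of A x y"
    using td \<open>x \<noteq> y\<close> unfolding totally_disconnected_space_def connected_component_of_def by blast
  ultimately have "\<not> quasi_component_of A x y" by simp
  then obtain T where T: "closedin A T" "openin A T" "x \<in> T \<longleftrightarrow> y \<notin> T"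
    using assms(2,3) unfolding quasi_component_of_def by blast
  show thesis
  proof (cases "x \<in> T")
    case True
    then show thesis using T that by blast
  next
    case False
    then show thesis
      using T assms(2,3) that[of "topspace A - T"] by (auto simp: openin_diff closedin_diff)
  qed
qed

section \<open>From profiniteness to equicontinuity\<close>

lemma profinite_imp_Stone_equicontinuous:
  fixes A :: "'a topology"
  assumes A: "topological_algebra \<Omega> A E" and prof: "profinite_algebra \<Omega> A E"
  shows "Stone_space A" "equicontinuous A (translation_monoid \<Omega> A E)"
proof -
  let ?M = "translation_monoid \<Omega> A E"
  \<comment> \<open>\<open>S\<close> retains only what is needed of the homomorphisms: a common
    discrete target and a kernel invariant under the monoid.\<close>
  define S where "S = {\<phi> :: 'a \<Rightarrow> nat. continuous_map A (discrete_topology UNIV) \<phi> \<and>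
    (\<forall>f\<in>?M. \<forall>u\<in>topspace A. \<forall>v\<in>topspace A. \<phi> u = \<phi> v \<longrightarrow> \<phi> (f u) = \<phi> (f v))}"
  have compact: "compact_space A"
    using prof by (simp add: profinite_algebra_def)
  have sep: "\<exists>\<phi>\<in>S. \<phi> x \<noteq> \<phi> y" if xy: "x \<in> topspace A" "y \<in> topspace A" "x \<noteq> y" for x y
  proof -
    obtain B :: "nat topology" and F \<phi> where B: "finite_discrete_algebra \<Omega> B F"
      and hom: "continuous_hom \<Omega> A E B F \<phi>" and ne: "\<phi> x \<noteq> \<phi> y"
      using prof xy unfolding profinite_algebra_def by metis
    have "continuous_map A (discrete_topology (topspace B)) \<phi>"
      using B hom by (simp add: finite_discrete_algebra_def continuous_hom_def)
    then have "continuous_map A (discrete_topology UNIV) \<phi>"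
      by (metis continuous_map_in_subtopology inf_top_left subtopology_discrete_topology)
    then show ?thesis
      using ne translation_monoid_respects_kernel[OF A hom] by (auto simp: S_def)
  qed
  have fib: "openin A {z \<in> topspace A. \<phi> z \<in> T}" if "\<phi> \<in> S" for \<phi> T
    using that by (auto simp: S_def intro: openin_continuous_map_preimage)
  have "Hausdorff_space A"
    unfolding Hausdorff_space_def
  proof (intro allI impI, elim conjE)
    fix x y assume xy: "x \<in> topspace A" "y \<in> topspace A" "x \<noteq> y"
    obtain \<phi> where \<phi>: "\<phi> \<in> S" "\<phi> x \<noteq> \<phi> y" using sep[OF xy] by blast
    show "\<exists>U V. openin A U \<and> openin A V \<and> x \<in> U \<and> y \<in> V \<and> disjnt U V"
      using fib[OF \<phi>(1), of "{\<phi> x}"] fib[OF \<phi>(1), of "{\<phi> y}"] xy \<phi>(2)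
      by (intro exI[of _ "{z \<in> topspace A. \<phi> z \<in> {\<phi> x}}"] exI[of _ "{z \<in> topspace A. \<phi> z \<in> {\<phi> y}}"])
        (auto simp: disjnt_iff)
  qed
  moreover have "totally_disconnected_space A"
    unfolding totally_disconnected_space_def
  proof (intro allI impI ballI)
    fix C x y assume C: "connectedin A C" and xy: "x \<in> C" "y \<in> C"
    show "x = y"
    proof (rule ccontr)
      assume "x \<noteq> y"
      then obtain \<phi> where \<phi>: "\<phi> \<in> S" "\<phi> x \<noteq> \<phi> y"
        using sep xy connectedin_subset_topspace[OF C] by blast
      then have "connectedin (discrete_topology UNIV) (\<phi> ` C)"
        using C connectedin_continuous_map_image by (auto simp: S_def)
      then show False
        using \<phi>(2) xy by (auto simp: connectedin_discrete_topology)
    qed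
  qed
  ultimately show "Stone_space A"
    using compact by (simp add: Stone_space_def)
  show "equicontinuous A ?M"
    unfolding equicontinuous_def
  proof (intro ballI)
    fix z \<alpha> assume z: "z \<in> topspace A" and "\<alpha> \<in> entourages A"
    then obtain W where W: "openin (prod_topology A A) W" "Id_on (topspace A) \<subseteq> W" "W \<subseteq> \<alpha>"
      by (auto simp: entourages_def)
    \<comment> \<open>\<open>D \<phi>\<close> is the complement of the kernel of
      \<open>\<phi>\<close>. A point outside \<open>W\<close> is off the diagonal, so these open
      sets cover the compact complement of \<open>W\<close>.\<close>
    define D where "D \<phi> = {p \<in> topspace (prod_topology A A). \<phi> (fst p) \<noteq> \<phi> (snd p)}"
      for \<phi> :: "'a \<Rightarrow> nat"
    have D: "openin (prod_topology A A) (D \<phi>)" if "\<phi> \<in> S" for \<phi>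
    proof -
      have "D \<phi> = (\<Union>k. {z \<in> topspace A. \<phi> z \<in> {k}} \<times> {z \<in> topspace A. \<phi> z \<in> - {k}})"
        by (auto simp: D_def)
      also have "openin (prod_topology A A) \<dots>"
      proof (rule openin_Union, elim rangeE, simp only:)
        show "openin (prod_topology A A)
            ({z \<in> topspace A. \<phi> z \<in> {k}} \<times> {z \<in> topspace A. \<phi> z \<in> - {k}})" for k
          using fib[OF that, of "{k}"] fib[OF that, of "- {k}"] openin_prod_Times_iff by blast
      qed
      finally show ?thesis .
    qed
    have "closedin (prod_topology A A) (topspace (prod_topology A A) - W)"
      using W(1) by (intro closedin_diff closedin_topspace)
    then have "compactin (prod_topology A A) (topspace (prod_topology A A) - W)"
      using compact by (simp add: closedin_compact_space compact_space_prod_topology)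
    moreover have "topspace (prod_topology A A) - W \<subseteq> \<Union> (D ` S)"
    proof
      fix p assume p: "p \<in> topspace (prod_topology A A) - W"
      then have "fst p \<noteq> snd p"
        using W(2) by (cases p) (auto simp: Id_on_def)
      with p show "p \<in> \<Union> (D ` S)"
        using sep[of "fst p" "snd p"] by (auto simp: D_def)
    qed
    ultimately have "\<exists>\<D>. finite \<D> \<and> \<D> \<subseteq> D ` S \<and> topspace (prod_topology A A) - W \<subseteq> \<Union>\<D>"
      using D by (intro compactinD) auto
    \<comment> \<open>In other words, the common kernel of the finitely many maps in
      \<open>P\<close> lies in \<open>W\<close>.\<close>
    then obtain P where P: "finite P" "P \<subseteq> S" "topspace (prod_topology A A) - W \<subseteq> \<Union> (D ` P)"
      by (metis finite_subset_image)
    \<comment> \<open>The class of \<open>z\<close> under this common kernel. Intersecting with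
      \<open>topspace A\<close> covers the case that \<open>P\<close> is empty.\<close>
    define U where "U = topspace A \<inter> (\<Inter>\<phi>\<in>P. {u \<in> topspace A. \<phi> u \<in> {\<phi> z}})"
    have "openin A U"
      unfolding U_def
    proof (cases "P = {}")
      case False
      then have "openin A (\<Inter>\<phi>\<in>P. {u \<in> topspace A. \<phi> u \<in> {\<phi> z}})"
        using P(1,2) fib by (intro openin_Inter) blast+
      then show "openin A (topspace A \<inter> (\<Inter>\<phi>\<in>P. {u \<in> topspace A. \<phi> u \<in> {\<phi> z}}))"
        by (intro openin_Int) auto
    qed simp
    moreover have "z \<in> U" using z by (simp add: U_def)
    moreover have "f ` U \<times> f ` U \<subseteq> \<alpha>" if f: "f \<in> ?M" for f
    proof clarify
      fix u v assume uv: "u \<in> U" "v \<in> U"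
      have "\<phi> (f u) = \<phi> (f v)" if "\<phi> \<in> P" for \<phi>
      proof -
        have "\<phi> \<in> S" "u \<in> topspace A" "v \<in> topspace A" "\<phi> u = \<phi> v"
          using P uv that by (auto simp: U_def)
        then show ?thesis using f unfolding S_def by blast
      qed
      then have "(f u, f v) \<notin> \<Union> (D ` P)" by (auto simp: D_def)
      moreover have "f u \<in> topspace A" "f v \<in> topspace A"
        using uv translation_monoid_in_topspace[OF A f] by (auto simp: U_def)
      ultimately have "(f u, f v) \<in> W" using P(3) by auto
      then show "(f u, f v) \<in> \<alpha>" using W(3) by blast
    qed
    ultimately show "\<exists>U. openin A U \<and> z \<in> U \<and> (\<forall>f\<in>?M. f ` U \<times> f ` U \<subseteq> \<alpha>)"
      by blast
  qed
qed

section \<open>From equicontinuity to profiniteness\<close>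

lemma Stone_equicontinuous_imp_profinite:
  fixes A :: "'a topology"
  assumes A: "topological_algebra \<Omega> A E" and Stone: "Stone_space A"
    and equi: "equicontinuous A (translation_monoid \<Omega> A E)"
  shows "profinite_algebra \<Omega> A E"
\<comment> \<open>This rule admits a finite algebra carried by the type \<open>'a\<close>, so points
  of \<open>A\<close> can represent the classes.\<close>
proof (rule profinite_algebraI)
  let ?M = "translation_monoid \<Omega> A E"
  show compact: "compact_space A" using Stone by (simp add: Stone_space_def)
  fix x y assume xy: "x \<in> topspace A" "y \<in> topspace A" "x \<noteq> y"
  obtain K where K: "openin A K" "closedin A K" "x \<in> K" "y \<notin> K"
    using Stone_space_clopen_separation[OF Stone xy] .
  \<comment> \<open>The syntactic congruence of \<open>K\<close>: the coarsest equivalence on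
    \<open>A\<close> that is compatible with translations and has \<open>K\<close> as a union of
    classes.\<close>
  define R where "R u v \<longleftrightarrow> u \<in> topspace A \<and> v \<in> topspace A \<and> (\<forall>f\<in>?M. f u \<in> K \<longleftrightarrow> f v \<in> K)" for u v
  have refl: "R u u" if "u \<in> topspace A" for u using that by (simp add: R_def)
  have sym: "R v u" if "R u v" for u v using that by (simp add: R_def)
  have trans: "R u w" if "R u v" "R v w" for u v w using that by (simp add: R_def)
  have transl: "R (t u) (t v)" if t: "t \<in> algebra_translations \<Omega> A E" and uv: "R u v" for t u v
  proof -
    have tM: "t \<in> ?M" using t by (rule translation_monoid.gen)
    \<comment> \<open>The test by \<open>f\<close> at \<open>t u\<close> and \<open>t v\<close> is
      the test by the composite of \<open>f\<close> and \<open>t\<close>, again in the monoid, at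
      \<open>u\<close> and \<open>v\<close>.\<close>
    have "f (t u) \<in> K \<longleftrightarrow> f (t v) \<in> K" if "f \<in> ?M" for f
      using translation_monoid.mult[OF that tM] uv by (force simp: R_def compose_def)
    then show ?thesis
      using uv translation_monoid_in_topspace[OF A tM] by (simp add: R_def)
  qed
  have nbhd: "\<exists>U. openin A U \<and> z \<in> U \<and> (\<forall>u\<in>U. R z u)" if z: "z \<in> topspace A" for z
  proof -
    \<comment> \<open>Pairs on the same side of \<open>K\<close> form an open set because
      \<open>K\<close> is clopen. Equicontinuity for this entourage yields one neighbourhood that
      serves all tests at once.\<close>
    let ?\<alpha> = "K \<times> K \<union> (topspace A - K) \<times> (topspace A - K)"
    have "openin (prod_topology A A) ?\<alpha>"
      using K by (intro openin_Un) (auto simp: openin_prod_Times_iff openin_diff)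
    then have "?\<alpha> \<in> entourages A"
      using openin_subset[OF K(1)] by (auto simp: entourages_def intro!: exI[of _ ?\<alpha>])
    then obtain U where U: "openin A U" "z \<in> U" "\<forall>f\<in>?M. f ` U \<times> f ` U \<subseteq> ?\<alpha>"
      using equi z unfolding equicontinuous_def by metis
    have "R z u" if "u \<in> U" for u
    proof -
      have "f z \<in> K \<longleftrightarrow> f u \<in> K" if "f \<in> ?M" for f
      proof -
        have "(f z, f u) \<in> ?\<alpha>" using U \<open>u \<in> U\<close> that by blast
        then show ?thesis by auto
      qed
      then show ?thesis
        using z that openin_subset[OF U(1)] by (auto simp: R_def)
    qed
    then show ?thesis using U by blast
  qed
  \<comment> \<open>The quotient is realised on a set of representatives, chosen by \<open>r\<close>.\<close>
  define r where "r u = (SOME v. R u v)" for u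
  have r: "R u (r u)" if "u \<in> topspace A" for u
    unfolding r_def using refl[OF that] by (rule someI)
  have r_eq: "r u = r v" if "R u v" for u v
  proof -
    \<comment> \<open>Related points satisfy the same predicate, so the choice operator picks the
      same representative.\<close>
    have "R u = R v" using that sym trans by blast
    then show ?thesis by (simp add: r_def)
  qed
  have r_top: "r u \<in> topspace A" if "u \<in> topspace A" for u
    using r[OF that] by (simp add: R_def)
  define B where "B = discrete_topology (r ` topspace A)"
  define F where "F n p = r (E n p)" for n p
  have cr: "continuous_map A B r"
    unfolding continuous_map_def
  proof (intro conjI allI impI)
    show "r \<in> topspace A \<rightarrow> topspace B" by (simp add: B_def)
    fix T assume "openin B T"
    show "openin A {u \<in> topspace A. r u \<in> T}"
    proof (subst openin_subopen, clarify)
      fix u assume u: "u \<in> topspace A" "r u \<in> T"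
      obtain U where U: "openin A U" "u \<in> U" "\<forall>v\<in>U. R u v" using nbhd[OF u(1)] by blast
      have "r v = r u" if "v \<in> U" for v
        using U(3) that by (metis r_eq)
      then have "U \<subseteq> {u \<in> topspace A. r u \<in> T}"
        using u(2) openin_subset[OF U(1)] by auto
      then show "\<exists>U. openin A U \<and> u \<in> U \<and> U \<subseteq> {u \<in> topspace A. r u \<in> T}" using U by blast
    qed
  qed
  \<comment> \<open>A compact subset of a discrete space is finite.\<close>
  have fin: "finite (r ` topspace A)"
    using image_compactin[OF compact[unfolded compact_space_def] cr]
    by (simp add: B_def compactin_discrete_topology)
  \<comment> \<open>The inclusion of the discrete space \<open>B\<close> is continuous, so
    \<open>F n\<close> is continuous as inclusion of arguments, then \<open>E n\<close>, then
    \<open>r\<close>.\<close>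
  have cB: "continuous_map B A (\<lambda>b. b)"
    using r_top by (auto simp: B_def)
  have "continuous_map (prod_topology (\<Omega> n) (product_topology (\<lambda>i. B) {..<n})) B (F n)" for n
  proof -
    have "continuous_map (product_topology (\<lambda>i. B) {..<n}) (product_topology (\<lambda>i. A) {..<n}) (\<lambda>b. b)"
      using continuous_map_compose[OF continuous_map_product_projection[where X = "\<lambda>i. B"] cB]
      by (force simp: continuous_map_componentwise o_def PiE_iff)
    then have "continuous_map (prod_topology (\<Omega> n) (product_topology (\<lambda>i. B) {..<n}))
        (prod_topology (\<Omega> n) (product_topology (\<lambda>i. A) {..<n})) (\<lambda>p. (fst p, snd p))"
      using continuous_map_compose[OF continuous_map_snd]
      by (intro continuous_map_pairedI continuous_map_fst) (auto simp: o_def)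
    moreover have "continuous_map (prod_topology (\<Omega> n) (product_topology (\<lambda>i. A) {..<n})) A (E n)"
      using A by (simp add: topological_algebra_def)
    ultimately have "continuous_map (prod_topology (\<Omega> n) (product_topology (\<lambda>i. B) {..<n})) B
        (r \<circ> (E n \<circ> (\<lambda>p. (fst p, snd p))))"
      by (intro continuous_map_compose[OF _ cr] continuous_map_compose)
    then show ?thesis by (simp add: F_def[abs_def] o_def)
  qed
  then have "finite_discrete_algebra \<Omega> B F"
    using fin by (simp add: finite_discrete_algebra_def topological_algebra_def B_def)
  moreover have "continuous_hom \<Omega> A E B F r"
    unfolding continuous_hom_def
  proof (intro conjI allI ballI cr)
    fix n \<omega> a assume \<omega>: "\<omega> \<in> topspace (\<Omega> n)" and a: "a \<in> {..<n} \<rightarrow>\<^sub>E topspace A"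
    have ra: "(\<lambda>i\<in>{..<n}. r (a i)) \<in> {..<n} \<rightarrow>\<^sub>E topspace A"
      using a r_top by (intro restrict_PiE_iff[THEN iffD2]) auto
    \<comment> \<open>Replacing every argument by its representative keeps the value in its class,
      which makes \<open>r\<close> a homomorphism.\<close>
    have "R (E n (\<omega>, a)) (E n (\<omega>, \<lambda>i\<in>{..<n}. r (a i)))"
    proof (rule operation_compatible_if_translation_compatible[OF A _ _ _ \<omega> a ra])
      show "R (a i) ((\<lambda>i\<in>{..<n}. r (a i)) i)" if "i < n" for i
        using that r PiE_mem[OF a] by simp
      show "R u w" if "R u v" "R v w" for u v w
        using that by (rule trans)
    qed (simp_all add: refl transl)
    then show "r (E n (\<omega>, a)) = F n (\<omega>, \<lambda>i\<in>{..<n}. r (a i))"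
      unfolding F_def by (rule r_eq)
  qed
  moreover have "r x \<noteq> r y"
  proof
    assume "r x = r y"
    then have "R x y" using r[OF xy(1)] r[OF xy(2)] sym trans by metis
    then show False
      \<comment> \<open>The identity in the monoid tests membership in \<open>K\<close> itself,
        where \<open>x\<close> and \<open>y\<close> differ.\<close>
      using translation_monoid.one[of A \<Omega> E] K xy by (force simp: R_def)
  qed
  ultimately show "\<exists>(B :: 'a topology) F \<phi>.
      finite_discrete_algebra \<Omega> B F \<and> continuous_hom \<Omega> A E B F \<phi> \<and> \<phi> x \<noteq> \<phi> y"
    by blast
qed

theorem theorem4p4:
  fixes \<Omega> :: "nat \<Rightarrow> 'o topology"
    and A :: "'a topology"
    and E :: "nat \<Rightarrow> 'o \<times> (nat \<Rightarrow> 'a) \<Rightarrow> 'a"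
  assumes "continuous_signature \<Omega>"
    and "topological_algebra \<Omega> A E"
  shows "profinite_algebra \<Omega> A E \<longleftrightarrow>
         Stone_space A \<and> equicontinuous A (translation_monoid \<Omega> A E)"
  using profinite_imp_Stone_equicontinuous[OF assms(2)]
    Stone_equicontinuous_imp_profinite[OF assms(2)]
  by blast

end
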